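(* Let $k\in\mathbb{N}_0$ and let $(F_i)_{i\in I}$ be a finite acyclic family of clause-sets. If $F_i\in\mathcal{PC}_k$ for all $i\in I$, then $\bigcup_{i\in I}F_i\in\mathcal{PC}_k$.
   Context: Clauses are finite sets of literals without complementary pairs ($\bot$ empty clause); clause-sets are finite sets of clauses (CNF). For a partial assignment $\varphi$, $\varphi*F$ deletes satisfied clauses and falsified literals. A literal $x$ is forced for $F$ if $\langle x\to0\rangle*F$ is unsatisfiable. Reductions $r_k$: $r_0(F)=\{\bot\}$ if $\bot\in F$, else $F$; $r_{k+1}(F)=r_{k+1}(\langle x\to1\rangle*F)$ if some literal $x$ over $\mathrm{var}(F)$ has $r_k(\langle x\to0\rangle*F)=\{\bot\}$, else $r_{k+1}(F)=F$ (independent of choices). The p-hardness $\mathrm{phd}(F)$ is the least $k$ such that for every partial assignment $\varphi$: if $\varphi*F$ is unsatisfiable then $r_k(\varphi*F)=\{\bot\}$, and otherwise $r_k(\varphi*F)$ has no forced literals. $\mathcal{PC}_k=\{F:\mathrm{phd}(F)\le k\}$. The incidence graph of a family $(F_i)_{i\in I}$ is the bipartite graph with parts $\bigcup_{i}\mathrm{var}(F_i)$ and $I$, with an edge between $v$ and $i$ iff $v\in\mathrm{var}(F_i)$; the family is acyclic if this graph has no cycle. *)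

theory Defs
  imports Main "HOL-Library.While_Combinator"
begin

datatype 'v lit = Pos (lit_var: 'v) | Neg (lit_var: 'v)

type_synonym 'v clause = "'v lit set"
type_synonym 'v cnf = "'v clause set"

definition is_clause :: "'v clause \<Rightarrow> bool" where
  "is_clause C \<longleftrightarrow> finite C \<and> (\<nexists>v. Pos v \<in> C \<and> Neg v \<in> C)"

definition is_clause_set :: "'v cnf \<Rightarrow> bool" where
  "is_clause_set F \<longleftrightarrow> finite F \<and> (\<forall>C\<in>F. is_clause C)"

definition cnf_vars :: "'v cnf \<Rightarrow> 'v set" where
  "cnf_vars F = lit_var ` \<Union>F"

text \<open>Partial assignments are maps \<open>'v \<rightharpoonup> bool\<close> with finite domain.\<close>

fun lit_val :: "('v \<rightharpoonup> bool) \<Rightarrow> 'v lit \<Rightarrow> bool option" where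
  "lit_val \<phi> (Pos v) = \<phi> v"
| "lit_val \<phi> (Neg v) = map_option Not (\<phi> v)"

fun lit_assign :: "'v lit \<Rightarrow> bool \<Rightarrow> ('v \<rightharpoonup> bool)" where
  "lit_assign (Pos v) b = [v \<mapsto> b]"
| "lit_assign (Neg v) b = [v \<mapsto> \<not> b]"

definition apply_pass :: "('v \<rightharpoonup> bool) \<Rightarrow> 'v cnf \<Rightarrow> 'v cnf" (infixr "\<star>" 75) where
  "\<phi> \<star> F = {{x \<in> C. lit_val \<phi> x \<noteq> Some False} | C.
              C \<in> F \<and> (\<forall>x\<in>C. lit_val \<phi> x \<noteq> Some True)}"

definition satisfiable :: "'v cnf \<Rightarrow> bool" where
  "satisfiable F \<longleftrightarrow> (\<exists>\<phi>. finite (dom \<phi>) \<and> \<phi> \<star> F = {})"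

definition forced :: "'v cnf \<Rightarrow> 'v lit \<Rightarrow> bool" where
  "forced F x \<longleftrightarrow> \<not> satisfiable (lit_assign x False \<star> F)"

text \<open>The loop is the recursion in the lemma \<open>red_Suc\<close> below; the choice of \<open>x\<close> is
  resolved by \<open>SOME\<close>. On clause-sets it terminates, as every step removes a variable.\<close>

primrec red :: "nat \<Rightarrow> 'v cnf \<Rightarrow> 'v cnf" where
  "red 0 = (\<lambda>F. if {} \<in> F then {{}} else F)"
| "red (Suc k) =
     while (\<lambda>F. \<exists>x. lit_var x \<in> cnf_vars F \<and> red k (lit_assign x False \<star> F) = {{}})
       (\<lambda>F. lit_assign
              (SOME x. lit_var x \<in> cnf_vars F \<and> red k (lit_assign x False \<star> F) = {{}}) True \<star> F)"

lemma red_Suc: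
  "red (Suc k) F =
     (if \<exists>x. lit_var x \<in> cnf_vars F \<and> red k (lit_assign x False \<star> F) = {{}}
      then red (Suc k) (lit_assign
             (SOME x. lit_var x \<in> cnf_vars F \<and> red k (lit_assign x False \<star> F) = {{}}) True \<star> F)
      else F)"
  unfolding red.simps(2) by (subst while_unfold) (rule refl)

definition phd_bound :: "'v cnf \<Rightarrow> nat \<Rightarrow> bool" where
  "phd_bound F k \<longleftrightarrow> (\<forall>\<phi>. finite (dom \<phi>) \<longrightarrow>
     (if satisfiable (\<phi> \<star> F) then \<not> (\<exists>x. forced (red k (\<phi> \<star> F)) x)
      else red k (\<phi> \<star> F) = {{}}))"

definition phd :: "'v cnf \<Rightarrow> nat" where
  "phd F = (LEAST k. phd_bound F k)"

definition PC :: "nat \<Rightarrow> 'v cnf set" where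
  "PC k = {F. is_clause_set F \<and> phd F \<le> k}"

text \<open>Undirected simple graphs are pairs of a vertex set and a set of two-element edges.\<close>

type_synonym 'a ugraph = "'a set \<times> 'a set set"

definition is_cycle :: "'a ugraph \<Rightarrow> 'a list \<Rightarrow> bool" where
  "is_cycle G p \<longleftrightarrow> length p \<ge> 3 \<and> distinct p \<and> set p \<subseteq> fst G \<and>
     (\<forall>j < length p. {p ! j, p ! (Suc j mod length p)} \<in> snd G)"

definition incidence_graph :: "'i set \<Rightarrow> ('i \<Rightarrow> 'v cnf) \<Rightarrow> ('v + 'i) ugraph" where
  "incidence_graph I F =
     (Inl ` (\<Union>i\<in>I. cnf_vars (F i)) \<union> Inr ` I,
      {{Inl v, Inr i} | v i. i \<in> I \<and> v \<in> cnf_vars (F i)})"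

definition acyclic_family :: "'i set \<Rightarrow> ('i \<Rightarrow> 'v cnf) \<Rightarrow> bool" where
  "acyclic_family I F \<longleftrightarrow> (\<nexists>p. is_cycle (incidence_graph I F) p)"

subsection \<open>The minimum defining \<open>phd\<close> exists\<close>

lemma finite_cnf_vars: "is_clause_set F \<Longrightarrow> finite (cnf_vars F)"
  by (auto simp: is_clause_set_def is_clause_def cnf_vars_def)

lemma is_clause_set_apply: assumes "is_clause_set F" shows "is_clause_set (\<phi> \<star> F)"
proof -
  have "\<phi> \<star> F \<subseteq> (\<lambda>C. {x \<in> C. lit_val \<phi> x \<noteq> Some False}) ` F"
    by (auto simp: apply_pass_def)
  moreover have "finite F" using assms by (simp add: is_clause_set_def)
  ultimately have "finite (\<phi> \<star> F)" by (meson finite_imageI finite_subset)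
  moreover have "\<forall>C\<in>\<phi> \<star> F. is_clause C"
    using assms by (auto simp: apply_pass_def is_clause_set_def is_clause_def)
  ultimately show ?thesis by (simp add: is_clause_set_def)
qed

lemma cnf_vars_apply: "cnf_vars (\<phi> \<star> F) \<subseteq> cnf_vars F"
  by (auto simp: apply_pass_def cnf_vars_def)

lemma cnf_vars_lit_assign: "cnf_vars (lit_assign x b \<star> F) \<subseteq> cnf_vars F - {lit_var x}"
proof -
  have "lit_val (lit_assign x b) y \<noteq> None" if "lit_var y = lit_var x" for y
    using that by (cases x; cases y) auto
  then have "lit_var y \<noteq> lit_var x"
    if "y \<in> C" "C \<in> lit_assign x b \<star> F" for y C
    using that by (fastforce simp: apply_pass_def)
  then show ?thesis using cnf_vars_apply[of "lit_assign x b" F] by (fastforce simp: cnf_vars_def)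
qed

lemma lit_val_add:
  "lit_val (\<phi> ++ \<psi>) x = (case lit_val \<psi> x of None \<Rightarrow> lit_val \<phi> x | Some b \<Rightarrow> Some b)"
  by (cases x) (auto simp: map_add_def split: option.split)

lemma satisfiable_apply:
  assumes "satisfiable (\<psi> \<star> F)" "finite (dom \<psi>)" shows "satisfiable F"
proof -
  obtain \<phi> where \<phi>: "finite (dom \<phi>)" "\<phi> \<star> \<psi> \<star> F = {}"
    using assms by (auto simp: satisfiable_def)
  have "\<exists>x\<in>C. lit_val (\<phi> ++ \<psi>) x = Some True" if "C \<in> F" for C
  proof (cases "\<exists>x\<in>C. lit_val \<psi> x = Some True")
    case True
    then obtain x where "x \<in> C" "lit_val \<psi> x = Some True" by blast
    then show ?thesis by (intro bexI[of _ x]) (simp_all add: lit_val_add)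
  next
    case False
    then have "{x \<in> C. lit_val \<psi> x \<noteq> Some False} \<in> \<psi> \<star> F"
      using that by (auto simp: apply_pass_def)
    then obtain x where "x \<in> C" "lit_val \<psi> x \<noteq> Some False" "lit_val \<phi> x = Some True"
      using \<phi>(2) unfolding apply_pass_def[of \<phi>] by blast
    moreover from this False have "lit_val \<psi> x = None"
      by (cases "lit_val \<psi> x") auto
    ultimately show ?thesis by (intro bexI[of _ x]) (simp_all add: lit_val_add)
  qed
  then have "(\<phi> ++ \<psi>) \<star> F = {}" by (auto simp: apply_pass_def)
  then show ?thesis using \<phi>(1) assms(2) unfolding satisfiable_def
    by (metis dom_map_add finite_UnI)
qed

lemma finite_dom_lit_assign: "finite (dom (lit_assign x b))"
  by (cases x) auto

lemma satisfiable_split: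
  assumes "satisfiable F"
  shows "satisfiable (lit_assign x False \<star> F) \<or> satisfiable (lit_assign x True \<star> F)"
proof -
  obtain \<phi> where \<phi>: "finite (dom \<phi>)" "\<phi> \<star> F = {}"
    using assms by (auto simp: satisfiable_def)
  define b where "b \<longleftrightarrow> lit_val \<phi> x \<noteq> Some False"
  have b: "lit_val (lit_assign x b) y \<noteq> Some False" if "lit_val \<phi> y = Some True" for y
    using that unfolding b_def by (cases x; cases y) auto
  have "\<exists>y\<in>C. lit_val \<phi> y = Some True" if "C \<in> F" for C
    using that \<phi>(2) unfolding apply_pass_def by blast
  then have "\<phi> \<star> lit_assign x b \<star> F = {}"
    using b unfolding apply_pass_def by blast
  then have "satisfiable (lit_assign x b \<star> F)" using \<phi>(1) by (auto simp: satisfiable_def)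
  then show ?thesis by (cases b) auto
qed

lemma red_Suc_result:
  assumes "is_clause_set F"
    and sound: "\<And>F :: 'v cnf. is_clause_set F \<Longrightarrow> red k F = {{}} \<Longrightarrow> \<not> satisfiable F"
  defines "G \<equiv> red (Suc k) (F :: 'v cnf)"
  shows "is_clause_set G \<and> cnf_vars G \<subseteq> cnf_vars F \<and> (satisfiable G \<longleftrightarrow> satisfiable F) \<and>
         (\<nexists>x. lit_var x \<in> cnf_vars G \<and> red k (lit_assign x False \<star> G) = {{}})"
  using assms(1) unfolding G_def
proof (induction "card (cnf_vars F)" arbitrary: F rule: less_induct)
  case less
  let ?P = "\<lambda>x. lit_var x \<in> cnf_vars F \<and> red k (lit_assign x False \<star> F) = {{}}"
  show ?case
  proof (cases "\<exists>x. ?P x")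
    case True
    define y where "y = (SOME x. ?P x)"
    define F' where "F' = lit_assign y True \<star> F"
    have eq: "red (Suc k) F = red (Suc k) F'"
      unfolding F'_def y_def by (subst red_Suc, subst if_P[OF True]) (rule refl)
    have y: "lit_var y \<in> cnf_vars F"
      using someI_ex[OF True] by (simp add: y_def)
    have sub: "cnf_vars F' \<subseteq> cnf_vars F - {lit_var y}"
      unfolding F'_def by (rule cnf_vars_lit_assign)
    then have "cnf_vars F' \<subset> cnf_vars F" using y by blast
    then have "card (cnf_vars F') < card (cnf_vars F)"
      using finite_cnf_vars[OF less.prems] by (rule psubset_card_mono[rotated])
    moreover have "is_clause_set F'"
      unfolding F'_def by (rule is_clause_set_apply[OF less.prems])
    moreover have "\<not> satisfiable (lit_assign y False \<star> F)"
      using sound is_clause_set_apply[OF less.prems] someI_ex[OF True] by (simp add: y_def)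
    then have "satisfiable F' \<longleftrightarrow> satisfiable F"
      unfolding F'_def using satisfiable_apply satisfiable_split finite_dom_lit_assign by blast
    ultimately show ?thesis using less.hyps[of F'] sub unfolding eq by blast
  next
    case False
    then have "red (Suc k) F = F" by (subst red_Suc, subst if_not_P) auto
    then show ?thesis using False less.prems by auto
  qed
qed

lemma no_vars: assumes "cnf_vars F = {}" shows "F = {} \<or> F = {{}}"
  using assms by (auto simp: cnf_vars_def)

lemma satisfiable_empty: "satisfiable {}"
  by (auto simp: satisfiable_def apply_pass_def intro!: exI[of _ Map.empty])

lemma not_satisfiable_empty_clause: "{} \<in> F \<Longrightarrow> \<not> satisfiable F"
  by (auto simp: satisfiable_def apply_pass_def)

lemma red_sound:
  "is_clause_set F \<Longrightarrow> red k F = {{}} \<Longrightarrow> \<not> satisfiable F"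
proof (induction k arbitrary: F)
  case 0
  then show ?case using not_satisfiable_empty_clause by (auto split: if_splits)
next
  case (Suc k)
  then show ?case using red_Suc_result[of F k] not_satisfiable_empty_clause[of "{{}}"] by auto
qed

lemma red_unsat:
  "is_clause_set F \<Longrightarrow> card (cnf_vars F) \<le> n \<Longrightarrow> \<not> satisfiable F \<Longrightarrow> red n F = {{}}"
proof (induction n arbitrary: F)
  case 0
  then have "cnf_vars F = {}" using finite_cnf_vars[of F] by auto
  then show ?case using no_vars[of F] 0 satisfiable_empty by auto
next
  case (Suc n)
  define G where "G = red (Suc n) F"
  have G: "is_clause_set G" "cnf_vars G \<subseteq> cnf_vars F" "\<not> satisfiable G"
      "\<And>x. lit_var x \<in> cnf_vars G \<Longrightarrow> red n (lit_assign x False \<star> G) \<noteq> {{}}"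
    using red_Suc_result[OF Suc.prems(1) red_sound, of n] Suc.prems(3) unfolding G_def by auto
  have "cnf_vars G = {}"
  proof (rule ccontr)
    assume "cnf_vars G \<noteq> {}"
    then obtain v where v: "lit_var (Pos v) \<in> cnf_vars G" by auto
    have "cnf_vars (lit_assign (Pos v) False \<star> G) \<subset> cnf_vars F"
      using cnf_vars_lit_assign[of "Pos v" False G] v G(2) by auto
    then have "card (cnf_vars (lit_assign (Pos v) False \<star> G)) < card (cnf_vars F)"
      using finite_cnf_vars[OF Suc.prems(1)] by (rule psubset_card_mono[rotated])
    then have "card (cnf_vars (lit_assign (Pos v) False \<star> G)) \<le> n" using Suc.prems(2) by simp
    moreover have "\<not> satisfiable (lit_assign (Pos v) False \<star> G)"
      using G(3) satisfiable_apply finite_dom_lit_assign by blast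
    ultimately show False using Suc.IH[OF is_clause_set_apply[OF G(1)]] G(4)[OF v] by blast
  qed
  then show ?case using no_vars[of G] G(3) satisfiable_empty G_def by auto
qed

lemma apply_not_in_vars:
  assumes "lit_var x \<notin> cnf_vars F" shows "lit_assign x b \<star> F = F"
proof -
  have "lit_val (lit_assign x b) y = None" if "y \<in> C" "C \<in> F" for y C
  proof -
    have "lit_var y \<noteq> lit_var x" using assms that unfolding cnf_vars_def by (metis UnionI imageI)
    then show ?thesis by (cases x; cases y) auto
  qed
  then have "{y \<in> C. lit_val (lit_assign x b) y \<noteq> Some False} = C"
    and "\<forall>y\<in>C. lit_val (lit_assign x b) y \<noteq> Some True" if "C \<in> F" for C
    using that by force+
  then show ?thesis unfolding apply_pass_def by (auto; metis)
qed

lemma phd_bound_Suc_card: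
  assumes F: "is_clause_set F" shows "phd_bound F (Suc (card (cnf_vars F)))"
  unfolding phd_bound_def
proof (intro allI impI)
  fix \<phi> :: "'a \<rightharpoonup> bool"
  let ?n = "card (cnf_vars F)"
  define H where "H = \<phi> \<star> F"
  have H: "is_clause_set H" unfolding H_def by (rule is_clause_set_apply[OF F])
  have cH: "card (cnf_vars H) \<le> ?n"
    unfolding H_def by (intro card_mono finite_cnf_vars F cnf_vars_apply)
  define G where "G = red (Suc ?n) H"
  have G: "is_clause_set G" "cnf_vars G \<subseteq> cnf_vars H" "satisfiable G \<longleftrightarrow> satisfiable H"
      "\<And>x. lit_var x \<in> cnf_vars G \<Longrightarrow> red ?n (lit_assign x False \<star> G) \<noteq> {{}}"
    using red_Suc_result[OF H red_sound, of ?n] unfolding G_def by auto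
  have "\<not> forced G x" if "satisfiable G" for x
  proof
    assume x: "forced G x"
    then have "lit_var x \<in> cnf_vars G"
      using apply_not_in_vars[of x G False] that unfolding forced_def by metis
    moreover have "card (cnf_vars (lit_assign x False \<star> G)) \<le> ?n"
      using cH G(2) cnf_vars_apply[of "lit_assign x False" G] finite_cnf_vars[OF H]
      by (meson card_mono order_trans)
    ultimately show False
      using red_unsat[OF is_clause_set_apply[OF G(1)], of "lit_assign x False" ?n] x G(4)[of x]
      unfolding forced_def by simp
  qed
  moreover have "G = {{}}" if "\<not> satisfiable H"
    unfolding G_def using red_unsat[OF H _ that, of "Suc ?n"] cH by simp
  ultimately show "if satisfiable (\<phi> \<star> F)
      then \<not> (\<exists>x. forced (red (Suc ?n) (\<phi> \<star> F)) x)
      else red (Suc ?n) (\<phi> \<star> F) = {{}}"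
    using G(3) unfolding G_def H_def by auto
qed

lemma phd_bound_phd: "is_clause_set F \<Longrightarrow> phd_bound F (phd F)"
  unfolding phd_def by (rule LeastI, rule phd_bound_Suc_card)

end

theory Submission imports Defs begin

text \<open>A reduct of \<open>F\<close> by \<open>r\<^sub>k\<close> other than \<open>{\<bottom>}\<close> has the form \<open>\<theta> * F\<close>, and since \<open>r\<^sub>k\<close>-refutability is inherited by
  instances and by supersets, each \<open>\<theta> * F\<^sub>i\<close> is itself fixed by \<open>r\<^sub>k\<close>. Hence membership in \<open>PC\<^sub>k\<close>
  makes each \<open>\<theta> * F\<^sub>i\<close> either \<open>{\<bottom>}\<close>, and then the whole reduct is \<open>{\<bottom>}\<close>, or satisfiable without
  forced literals. In the latter case every value of every variable extends to a model of each
  \<open>\<theta> * F\<^sub>i\<close>. A finite acyclic family has a member sharing at most one variable with the rest, as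
  otherwise a part of the incidence graph would have minimum degree two; gluing models along that
  variable shows by induction that the union is satisfiable without forced literals.\<close>

section \<open>Partial assignments\<close>

text \<open>Here \<open>\<psi>\<close> acts first and so decides the shared variables, just as the
  right argument of \<open>++\<close> does.\<close>

lemma apply_apply: "\<phi> \<star> \<psi> \<star> F = (\<phi> ++ \<psi>) \<star> F"
proof -
  have f: "lit_val (\<phi> ++ \<psi>) x \<noteq> Some False \<longleftrightarrow>
      lit_val \<psi> x \<noteq> Some False \<and> (lit_val \<psi> x = Some True \<or> lit_val \<phi> x \<noteq> Some False)" for x
    by (auto simp: lit_val_add split: option.split)
  have t: "lit_val (\<phi> ++ \<psi>) x \<noteq> Some True \<longleftrightarrow>
      lit_val \<psi> x \<noteq> Some True \<and> (lit_val \<psi> x = Some False \<or> lit_val \<phi> x \<noteq> Some True)" for x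
    by (auto simp: lit_val_add split: option.split)
  have set: "{x \<in> {x \<in> C. lit_val \<psi> x \<noteq> Some False}. lit_val \<phi> x \<noteq> Some False} =
      {x \<in> C. lit_val (\<phi> ++ \<psi>) x \<noteq> Some False}" if "\<forall>x\<in>C. lit_val \<psi> x \<noteq> Some True" for C
    using that unfolding f by blast
  show ?thesis
  proof (intro equalityI subsetI)
    fix D assume "D \<in> \<phi> \<star> \<psi> \<star> F"
    then obtain C where C: "C \<in> F" "\<forall>x\<in>C. lit_val \<psi> x \<noteq> Some True"
        "\<forall>x\<in>{x \<in> C. lit_val \<psi> x \<noteq> Some False}. lit_val \<phi> x \<noteq> Some True"
        "D = {x \<in> {x \<in> C. lit_val \<psi> x \<noteq> Some False}. lit_val \<phi> x \<noteq> Some False}"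
      unfolding apply_pass_def by blast
    have "\<forall>x\<in>C. lit_val (\<phi> ++ \<psi>) x \<noteq> Some True" unfolding t using C by blast
    then show "D \<in> (\<phi> ++ \<psi>) \<star> F"
      unfolding C(4) set[OF C(2)] using C(1) unfolding apply_pass_def by blast
  next
    fix D assume "D \<in> (\<phi> ++ \<psi>) \<star> F"
    then obtain C where C: "C \<in> F" "\<forall>x\<in>C. lit_val (\<phi> ++ \<psi>) x \<noteq> Some True"
        "D = {x \<in> C. lit_val (\<phi> ++ \<psi>) x \<noteq> Some False}"
      unfolding apply_pass_def by blast
    have \<psi>: "\<forall>x\<in>C. lit_val \<psi> x \<noteq> Some True" using C(2) unfolding t by blast
    then have "{x \<in> C. lit_val \<psi> x \<noteq> Some False} \<in> \<psi> \<star> F"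
      using C(1) unfolding apply_pass_def by blast
    moreover have "\<forall>x\<in>{x \<in> C. lit_val \<psi> x \<noteq> Some False}. lit_val \<phi> x \<noteq> Some True"
      using C(2) unfolding t by blast
    ultimately show "D \<in> \<phi> \<star> \<psi> \<star> F"
      unfolding C(3) set[OF \<psi>, symmetric] unfolding apply_pass_def[of \<phi>] by blast
  qed
qed

lemma apply_mono: "A \<subseteq> B \<Longrightarrow> \<phi> \<star> A \<subseteq> \<phi> \<star> B"
  unfolding apply_pass_def by blast

lemma apply_UN: "\<phi> \<star> (\<Union>i\<in>I. F i) = (\<Union>i\<in>I. \<phi> \<star> F i)"
  unfolding apply_pass_def by blast

lemma apply_Map_empty: "Map.empty \<star> F = F"
proof -
  have "lit_val Map.empty x = None" for x :: "'a lit" by (cases x) auto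
  then show ?thesis by (simp add: apply_pass_def)
qed

lemma empty_clause_apply: "{} \<in> F \<Longrightarrow> {} \<in> \<phi> \<star> F"
  unfolding apply_pass_def by blast

lemma apply_eq_empty_iff:
  "\<phi> \<star> F = {} \<longleftrightarrow> (\<forall>C\<in>F. \<exists>x\<in>C. lit_val \<phi> x = Some True)"
  unfolding apply_pass_def by blast

lemma lit_val_cong: "\<phi> (lit_var x) = \<psi> (lit_var x) \<Longrightarrow> lit_val \<phi> x = lit_val \<psi> x"
  by (cases x) auto

lemma apply_eq_empty_cong:
  assumes "\<And>v. v \<in> cnf_vars F \<Longrightarrow> \<phi> v = \<psi> v"
  shows "\<phi> \<star> F = {} \<longleftrightarrow> \<psi> \<star> F = {}"
proof -
  have "lit_val \<phi> x = lit_val \<psi> x" if "x \<in> C" "C \<in> F" for x C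
    using that assms by (intro lit_val_cong) (auto simp: cnf_vars_def)
  then show ?thesis unfolding apply_eq_empty_iff by auto
qed

lemma lit_assign_eq: "lit_assign x b = [lit_var x \<mapsto> (b \<longleftrightarrow> x = Pos (lit_var x))]"
  by (cases x) auto

section \<open>Reductions\<close>

lemma red_Suc_fixpoint:
  assumes "\<nexists>x. lit_var x \<in> cnf_vars F \<and> red k (lit_assign x False \<star> F) = {{}}"
  shows "red (Suc k) F = F"
  using assms by (subst red_Suc, subst if_not_P) auto

text \<open>Induction along the run of the loop, which ends because each round removes the chosen
  variable. The case \<open>step\<close> hides the choice made by \<open>SOME\<close> and keeps the
  refuted branch and the equality of the two results.\<close>

lemma red_Suc_induct [consumes 1, case_names fixpoint step]:
  assumes "is_clause_set F"
    and fp: "\<And>F. is_clause_set F \<Longrightarrow> red (Suc k) F = F \<Longrightarrow> P F"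
    and step: "\<And>F x. is_clause_set F \<Longrightarrow> red k (lit_assign x False \<star> F) = {{}} \<Longrightarrow>
      red (Suc k) F = red (Suc k) (lit_assign x True \<star> F) \<Longrightarrow> P (lit_assign x True \<star> F) \<Longrightarrow> P F"
  shows "P F"
  using assms(1)
proof (induction "card (cnf_vars F)" arbitrary: F rule: less_induct)
  case less
  let ?P = "\<lambda>x. lit_var x \<in> cnf_vars F \<and> red k (lit_assign x False \<star> F) = {{}}"
  show ?case
  proof (cases "\<exists>x. ?P x")
    case True
    define y where "y = (SOME x. ?P x)"
    have y: "?P y" using someI_ex[OF True] by (simp add: y_def)
    have eq: "red (Suc k) F = red (Suc k) (lit_assign y True \<star> F)"
      unfolding y_def by (subst red_Suc, subst if_P[OF True]) (rule refl)
    have "cnf_vars (lit_assign y True \<star> F) \<subset> cnf_vars F"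
      using cnf_vars_lit_assign[of y True F] y by blast
    then have "card (cnf_vars (lit_assign y True \<star> F)) < card (cnf_vars F)"
      using finite_cnf_vars[OF less.prems] by (rule psubset_card_mono[rotated])
    then have "P (lit_assign y True \<star> F)"
      using less.hyps is_clause_set_apply[OF less.prems] by blast
    then show ?thesis using step[OF less.prems _ eq] y by blast
  next
    case False
    then show ?thesis using fp[OF less.prems red_Suc_fixpoint] by blast
  qed
qed

lemma red_Suc_eq_apply:
  assumes "is_clause_set F"
  shows "\<exists>\<psi>. finite (dom \<psi>) \<and> red (Suc k) F = \<psi> \<star> F"
  using assms
proof (induction F rule: red_Suc_induct[where k = k])
  case (fixpoint F)
  then show ?case by (intro exI[of _ Map.empty]) (simp add: apply_Map_empty)
next
  case (step F x)
  then obtain \<psi> where "finite (dom \<psi>)" "red (Suc k) F = \<psi> \<star> lit_assign x True \<star> F" by auto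
  then show ?case using finite_dom_lit_assign[of x True]
    by (intro exI[of _ "\<psi> ++ lit_assign x True"]) (simp add: apply_apply)
qed

lemma red_Suc_irreducible:
  assumes "is_clause_set F" "lit_var x \<in> cnf_vars (red (Suc k) F)"
  shows "red k (lit_assign x False \<star> red (Suc k) F) \<noteq> {{}}"
proof -
  have "\<nexists>x. lit_var x \<in> cnf_vars (red (Suc k) F) \<and> red k (lit_assign x False \<star> red (Suc k) F) = {{}}"
    by (intro red_Suc_result[THEN conjunct2, THEN conjunct2, THEN conjunct2] assms(1))
      (rule red_sound)
  then show ?thesis using assms(2) by simp
qed

lemma red_Suc_satisfiable_iff:
  "is_clause_set F \<Longrightarrow> satisfiable (red (Suc k) F) \<longleftrightarrow> satisfiable F"
  by (intro red_Suc_result[THEN conjunct2, THEN conjunct2, THEN conjunct1]) (assumption, rule red_sound)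

lemma red_Suc_idem:
  assumes "is_clause_set F" shows "red (Suc k) (red (Suc k) F) = red (Suc k) F"
  by (rule red_Suc_fixpoint) (use red_Suc_irreducible[OF assms] in metis)

section \<open>Refutability of instances and supersets\<close>

lemma red_Suc_fixpointD:
  assumes "is_clause_set G" "red (Suc k) G = G" "lit_var x \<in> cnf_vars G"
  shows "red k (lit_assign x False \<star> G) \<noteq> {{}}"
  using red_Suc_irreducible[OF assms(1), of x k] assms(3) unfolding assms(2) .

text \<open>Instances and supersets are treated at once because the induction on \<open>k\<close>
  needs both together. The type token is there because \<open>'v\<close> occurs only in bound
  variables and \<open>k\<close> alone would not determine it.\<close>

definition refutation_mono :: "'v itself \<Rightarrow> nat \<Rightarrow> bool" where
  "refutation_mono _ k \<longleftrightarrow> (\<forall>(A :: 'v cnf) B \<theta>. is_clause_set A \<longrightarrow> is_clause_set B \<longrightarrow>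
     red k A = {{}} \<longrightarrow> \<theta> \<star> A \<subseteq> B \<longrightarrow> red k B = {{}})"

lemma refutation_monoD:
  assumes "refutation_mono TYPE('v) k" "is_clause_set A" "is_clause_set (B :: 'v cnf)"
    "red k A = {{}}" "\<theta> \<star> A \<subseteq> B"
  shows "red k B = {{}}"
  using assms unfolding refutation_mono_def by blast

text \<open>If \<open>G\<close> had a variable, setting it to 0 would again leave a superset of an
  instance of \<open>H\<close>, so \<open>red k\<close> would refute that branch and the loop would
  not have stopped at \<open>G\<close>. Hence \<open>G\<close> has no variables, and it is
  unsatisfiable.\<close>

lemma fixpoint_eq_empty_clause:
  assumes "refutation_mono TYPE('v) k" "is_clause_set (G :: 'v cnf)" "red (Suc k) G = G"
    and H: "is_clause_set H" "red k H = {{}}" "\<theta> \<star> H \<subseteq> G"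
  shows "G = {{}}"
proof -
  have "\<not> satisfiable G"
    using refutation_monoD[OF assms(1) H(1) assms(2) H(2,3)] red_sound assms(2) by blast
  moreover have "cnf_vars G = {}"
  proof (rule ccontr)
    assume "cnf_vars G \<noteq> {}"
    then obtain v where v: "lit_var (Pos v) \<in> cnf_vars G" by auto
    have "(lit_assign (Pos v) False ++ \<theta>) \<star> H \<subseteq> lit_assign (Pos v) False \<star> G"
      using apply_mono[OF H(3)] by (simp only: apply_apply[symmetric])
    then have "red k (lit_assign (Pos v) False \<star> G) = {{}}"
      using refutation_monoD[OF assms(1) H(1) is_clause_set_apply[OF assms(2)] H(2)] by blast
    then show False using red_Suc_fixpointD[OF assms(2,3) v] by blast
  qed
  ultimately show ?thesis using no_vars satisfiable_empty by blast
qed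

lemma map_add_single_eq: "\<theta> v = Some b \<Longrightarrow> \<theta> ++ [v \<mapsto> b] = \<theta>"
  by (rule ext) (auto simp: map_add_def)

lemma map_add_single_comm: "\<theta> v = None \<Longrightarrow> \<theta> ++ [v \<mapsto> b] = [v \<mapsto> b] ++ \<theta>"
  by (rule ext) (auto simp: map_add_def split: option.split)

text \<open>The refutation of \<open>A\<close> is followed round by round inside \<open>G\<close>:
  either \<open>\<theta>\<close> agrees with the assignment of the round and the next clause-set
  still has its \<open>\<theta>\<close>-instance in \<open>G\<close>, or an instance of the refuted
  branch \<open>?A0\<close> lies in \<open>G\<close>.\<close>

lemma fixpoint_absorbs_refutation:
  assumes mono: "refutation_mono TYPE('v) k"
    and G: "is_clause_set (G :: 'v cnf)" "red (Suc k) G = G"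
    and A: "is_clause_set A" "red (Suc k) A = {{}}" "\<theta> \<star> A \<subseteq> G"
  shows "{} \<in> G"
  using A
proof (induction A rule: red_Suc_induct[where k = k])
  case (fixpoint A)
  then show ?case using empty_clause_apply[of A \<theta>] by auto
next
  case (step A x)
  let ?v = "lit_var x"
  let ?A0 = "lit_assign x False \<star> A"
  have A0: "is_clause_set ?A0" by (rule is_clause_set_apply[OF step.hyps(1)])
  have absorb: "{} \<in> G" if "\<theta>' \<star> ?A0 \<subseteq> G" for \<theta>'
    using fixpoint_eq_empty_clause[OF mono G A0 step.hyps(2) that] by blast
  consider "lit_val \<theta> x = Some True" | "lit_val \<theta> x = Some False" | "\<theta> ?v = None"
    by (cases x; cases "\<theta> ?v") auto
  then show ?case
  proof cases
    case 1
    then have "\<theta> ++ lit_assign x True = \<theta>"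
      by (cases x) (auto intro!: map_add_single_eq)
    then show ?thesis using step by (simp add: apply_apply)
  next
    case 2
    then have "\<theta> ++ lit_assign x False = \<theta>"
      by (cases x) (auto intro!: map_add_single_eq)
    then have "\<theta> \<star> ?A0 \<subseteq> G" using step.prems by (simp add: apply_apply)
    then show ?thesis by (rule absorb)
  next
    case 3
    then have "\<theta> \<star> ?A0 = lit_assign x False \<star> \<theta> \<star> A"
      by (simp only: apply_apply lit_assign_eq map_add_single_comm)
    then have sub: "\<theta> \<star> ?A0 \<subseteq> lit_assign x False \<star> G"
      using apply_mono[OF step.prems(2)] by simp
    then have "red k (lit_assign x False \<star> G) = {{}}"
      using refutation_monoD[OF mono A0 is_clause_set_apply[OF G(1)] step.hyps(2)] by blast
    \<comment> \<open>\<open>G\<close> admits no further round, so a refuted branch on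
      \<open>?v\<close> is possible only if \<open>?v\<close> does not occur in \<open>G\<close>.
      Then the branch is \<open>G\<close> itself and contains an instance of
      \<open>?A0\<close>.\<close>
    then have "?v \<notin> cnf_vars G" using red_Suc_fixpointD[OF G] by blast
    then show ?thesis using sub absorb by (simp add: apply_not_in_vars)
  qed
qed

text \<open>No assignment removes the empty clause, so every branch is refuted one level below and
  the loop runs until no variable is left.\<close>

lemma fixpoint_empty_clause:
  assumes "is_clause_set G" "red k G = G" "{} \<in> G"
  shows "G = {{}}"
proof (cases k)
  case 0
  then show ?thesis using assms by simp
next
  case (Suc j)
  have ref: "red m F = {{}}" if "is_clause_set F" "{} \<in> F" for m and F :: "'a cnf"
    using that
  proof (induction m arbitrary: F)
    case (Suc m)
    let ?G = "red (Suc m) F"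
    obtain \<psi> where \<psi>: "?G = \<psi> \<star> F" using red_Suc_eq_apply[OF Suc.prems(1)] by blast
    have G: "is_clause_set ?G" "{} \<in> ?G"
      unfolding \<psi> using Suc.prems by (simp_all add: is_clause_set_apply empty_clause_apply)
    have "lit_var x \<notin> cnf_vars ?G" for x
      using red_Suc_fixpointD[OF G(1) red_Suc_idem[OF Suc.prems(1)], of x]
        Suc.IH[OF is_clause_set_apply[OF G(1)] empty_clause_apply[OF G(2)]] by blast
    then have "cnf_vars ?G = {}" using lit.sel(1) by (metis all_not_in_conv)
    then show ?case using no_vars G(2) by blast
  qed simp
  show ?thesis using ref[OF assms(1,3)] assms(2) by metis
qed

text \<open>In the induction step \<open>B\<close> is replaced by its reduct, which contains an
  instance of \<open>A\<close> under \<open>\<psi> ++ \<theta>\<close> and is a fixpoint, so that it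
  absorbs the refutation of \<open>A\<close>.\<close>

lemma refutation_mono: "refutation_mono TYPE('v) k"
proof (induction k)
  case 0
  then show ?case using empty_clause_apply
    by (fastforce simp: refutation_mono_def split: if_splits)
next
  case (Suc k)
  show ?case unfolding refutation_mono_def
  proof (intro allI impI)
    fix A B :: "'v cnf" and \<theta>
    assume A: "is_clause_set A" "red (Suc k) A = {{}}" and B: "is_clause_set B"
      and sub: "\<theta> \<star> A \<subseteq> B"
    let ?G = "red (Suc k) B"
    obtain \<psi> where \<psi>: "?G = \<psi> \<star> B" using red_Suc_eq_apply[OF B] by blast
    have G: "is_clause_set ?G" unfolding \<psi> by (rule is_clause_set_apply[OF B])
    have "(\<psi> ++ \<theta>) \<star> A \<subseteq> ?G"
      unfolding \<psi> using apply_mono[OF sub] by (simp add: apply_apply[symmetric])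
    then have "{} \<in> ?G"
      by (rule fixpoint_absorbs_refutation[OF Suc.IH G red_Suc_idem[OF B] A])
    then show "?G = {{}}" by (rule fixpoint_empty_clause[OF G red_Suc_idem[OF B]])
  qed
qed

section \<open>Fixpoints of subsets and of lower levels\<close>

lemma red_mono:
  assumes "is_clause_set A" "is_clause_set B" "red k A = {{}}" "A \<subseteq> B"
  shows "red k B = {{}}"
  using refutation_monoD[OF refutation_mono assms(1-3), of Map.empty] assms(4)
  by (simp add: apply_Map_empty)

text \<open>The result at level \<open>Suc k\<close> is both a fixpoint and an instance of
  \<open>A\<close>, which is refuted at level \<open>k\<close>.\<close>

lemma red_Suc_refutes:
  assumes "is_clause_set A" "red k A = {{}}" shows "red (Suc k) A = {{}}"
proof -
  obtain \<psi> where \<psi>: "red (Suc k) A = \<psi> \<star> A" using red_Suc_eq_apply[OF assms(1)] by blast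
  show ?thesis
    using fixpoint_eq_empty_clause[OF refutation_mono _ red_Suc_idem[OF assms(1)] assms, of \<psi>]
      is_clause_set_apply[OF assms(1), of \<psi>] unfolding \<psi> by blast
qed

text \<open>By monotonicity, a round that is possible on \<open>A\<close> would also be possible on
  \<open>B\<close>. This carries fixpoints of a union over to its members.\<close>

lemma fixpoint_subset:
  assumes "is_clause_set A" "is_clause_set B" "A \<subseteq> B" "red k B = B" "B \<noteq> {{}}"
  shows "red k A = A"
proof (cases k)
  case 0
  then show ?thesis using assms fixpoint_empty_clause[OF assms(2,4)] by auto
next
  case (Suc j)
  have "red j (lit_assign x False \<star> A) \<noteq> {{}}" if "lit_var x \<in> cnf_vars A" for x
  proof
    assume "red j (lit_assign x False \<star> A) = {{}}"
    then have "red j (lit_assign x False \<star> B) = {{}}"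
      by (rule red_mono[OF is_clause_set_apply[OF assms(1)] is_clause_set_apply[OF assms(2)]])
        (rule apply_mono[OF assms(3)])
    moreover have "lit_var x \<in> cnf_vars B" using that assms(3) by (auto simp: cnf_vars_def)
    ultimately show False using red_Suc_fixpointD[OF assms(2)] assms(4) Suc by blast
  qed
  then show ?thesis unfolding Suc by (intro red_Suc_fixpoint) blast
qed

lemma fixpoint_pred:
  assumes "is_clause_set G" "red (Suc k) G = G" shows "red k G = G"
proof (cases k)
  case 0
  then show ?thesis using fixpoint_empty_clause[OF assms] by auto
next
  case (Suc j)
  have "red j (lit_assign x False \<star> G) \<noteq> {{}}" if "lit_var x \<in> cnf_vars G" for x
  proof
    assume "red j (lit_assign x False \<star> G) = {{}}"
    then have "red k (lit_assign x False \<star> G) = {{}}"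
      unfolding Suc by (rule red_Suc_refutes[OF is_clause_set_apply[OF assms(1)]])
    then show False using red_Suc_fixpointD[OF assms that] by contradiction
  qed
  then show ?thesis unfolding Suc by (intro red_Suc_fixpoint) blast
qed

text \<open>Lets level 0 and the loop be handled alike: at level 0 a clause-set without the empty
  clause is its own reduct, under the empty assignment.\<close>

lemma red_fixpoint_cases:
  assumes "is_clause_set F"
  obtains "red k F = {{}}" "\<not> satisfiable F"
  | \<psi> where "finite (dom \<psi>)" "red k F = \<psi> \<star> F" "red k (\<psi> \<star> F) = \<psi> \<star> F" "\<psi> \<star> F \<noteq> {{}}"
      "satisfiable (\<psi> \<star> F) \<longleftrightarrow> satisfiable F"
proof (cases "red k F = {{}}")
  case True
  then show ?thesis using that(1) red_sound[OF assms] by blast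
next
  case False
  show ?thesis
  proof (cases k)
    case 0
    then have "red k F = F" using False by (auto split: if_splits)
    then show ?thesis using that(2)[of Map.empty] False by (simp add: apply_Map_empty)
  next
    case (Suc j)
    obtain \<psi> where \<psi>: "finite (dom \<psi>)" "red k F = \<psi> \<star> F"
      using red_Suc_eq_apply[OF assms] Suc by blast
    have idem: "red k (red k F) = red k F" unfolding Suc by (rule red_Suc_idem[OF assms])
    have sat: "satisfiable (red k F) \<longleftrightarrow> satisfiable F"
      unfolding Suc by (rule red_Suc_satisfiable_iff[OF assms])
    show ?thesis by (rule that(2)[OF \<psi>]) (use idem sat False in \<open>unfold \<psi>(2)\<close>)
  qed
qed

text \<open>Unless it is \<open>{{}}\<close>, the reduct of an instance of \<open>F\<close> is
  itself an instance of \<open>F\<close> at which the reduction has stopped. It suffices to look at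
  such instances, and \<open>red\<close> disappears from the conclusion.\<close>

lemma phd_bound_iff_fixpoints:
  assumes "is_clause_set F"
  shows "phd_bound F k \<longleftrightarrow> (\<forall>\<theta>. finite (dom \<theta>) \<longrightarrow> red k (\<theta> \<star> F) = \<theta> \<star> F \<longrightarrow> \<theta> \<star> F \<noteq> {{}} \<longrightarrow>
    satisfiable (\<theta> \<star> F) \<and> (\<nexists>x. forced (\<theta> \<star> F) x))" (is "_ \<longleftrightarrow> ?fix")
proof
  assume "phd_bound F k"
  then have bound: "if satisfiable (\<theta> \<star> F) then \<not> (\<exists>x. forced (red k (\<theta> \<star> F)) x)
      else red k (\<theta> \<star> F) = {{}}" if "finite (dom \<theta>)" for \<theta>
    using that unfolding phd_bound_def by blast
  show ?fix
  proof (intro allI impI)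
    fix \<theta> :: "'a \<rightharpoonup> bool"
    assume "finite (dom \<theta>)" and eq: "red k (\<theta> \<star> F) = \<theta> \<star> F" and ne: "\<theta> \<star> F \<noteq> {{}}"
    from bound[OF this(1)] ne show "satisfiable (\<theta> \<star> F) \<and> (\<nexists>x. forced (\<theta> \<star> F) x)"
      unfolding eq by (simp split: if_splits)
  qed
next
  assume fixpoints: ?fix
  show "phd_bound F k" unfolding phd_bound_def
  proof (intro allI impI)
    fix \<phi> :: "'a \<rightharpoonup> bool" assume \<phi>: "finite (dom \<phi>)"
    show "if satisfiable (\<phi> \<star> F) then \<not> (\<exists>x. forced (red k (\<phi> \<star> F)) x)
      else red k (\<phi> \<star> F) = {{}}"
    proof (cases rule: red_fixpoint_cases[OF is_clause_set_apply[OF assms, of \<phi>], of k])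
      case 1
      then show ?thesis by simp
    next
      case (2 \<psi>)
      \<comment> \<open>The assignment \<open>\<psi> ++ \<phi>\<close> leads from \<open>F\<close>
        directly to the reduct of \<open>\<phi> \<star> F\<close>.\<close>
      then have "satisfiable (\<psi> \<star> \<phi> \<star> F) \<and> (\<nexists>x. forced (\<psi> \<star> \<phi> \<star> F) x)"
        using fixpoints[rule_format, of "\<psi> ++ \<phi>"] \<phi> by (simp add: apply_apply)
      then show ?thesis using 2 by simp
    qed
  qed
qed

text \<open>A fixpoint of a higher level is one of each lower level, so raising the level leaves
  fewer instances to check. As \<open>phd\<close> is a minimum, this gives the bound at every
  \<open>k\<close> above it.\<close>

lemma phd_bound_mono:
  assumes "is_clause_set F" "phd_bound F k" "k \<le> m" shows "phd_bound F m"
  using assms(3,2)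
proof (induction m rule: dec_induct)
  case (step m)
  show ?case unfolding phd_bound_iff_fixpoints[OF assms(1)]
  proof (intro allI impI)
    fix \<theta> :: "'a \<rightharpoonup> bool"
    assume \<theta>: "finite (dom \<theta>)" "red (Suc m) (\<theta> \<star> F) = \<theta> \<star> F" "\<theta> \<star> F \<noteq> {{}}"
    have "red m (\<theta> \<star> F) = \<theta> \<star> F"
      by (rule fixpoint_pred[OF is_clause_set_apply[OF assms(1)] \<theta>(2)])
    then show "satisfiable (\<theta> \<star> F) \<and> (\<nexists>x. forced (\<theta> \<star> F) x)"
      using step.IH[OF step.prems] \<theta>(1,3)
      unfolding phd_bound_iff_fixpoints[OF assms(1)] by simp
  qed
qed

lemma PC_iff_phd_bound: "F \<in> PC k \<longleftrightarrow> is_clause_set F \<and> phd_bound F k"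
proof
  assume "F \<in> PC k"
  then have F: "is_clause_set F" "phd F \<le> k" by (simp_all add: PC_def)
  then show "is_clause_set F \<and> phd_bound F k" using phd_bound_mono[OF F(1) phd_bound_phd] by blast
next
  assume "is_clause_set F \<and> phd_bound F k"
  then show "F \<in> PC k" by (simp add: PC_def phd_def Least_le)
qed

section \<open>Acyclic families\<close>

text \<open>In a longest path all neighbours in \<open>V\<close> of the first vertex lie on the
  path. One of them is not its successor, and the edge to it closes a cycle.\<close>

lemma min_degree_2_imp_cycle:
  assumes "finite V" "V \<noteq> {}" "V \<subseteq> fst G"
    and deg: "\<And>x. x \<in> V \<Longrightarrow> \<exists>y\<in>V. \<exists>z\<in>V. y \<noteq> z \<and> {x, y} \<in> snd G \<and> {x, z} \<in> snd G"
    and loopfree: "\<And>x. {x} \<notin> snd G"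
  shows "\<exists>p. is_cycle G p"
proof -
  let ?path = "\<lambda>p. p \<noteq> [] \<and> distinct p \<and> set p \<subseteq> V \<and>
    (\<forall>j. Suc j < length p \<longrightarrow> {p ! j, p ! Suc j} \<in> snd G)"
  obtain v where "v \<in> V" using assms(2) by blast
  then have "?path [v]" by simp
  moreover have "\<forall>p. ?path p \<longrightarrow> length p < Suc (card V)"
    using assms(1) by (metis card_mono distinct_card le_imp_less_Suc)
  ultimately obtain p where p: "?path p" and max: "\<And>q. ?path q \<Longrightarrow> length q \<le> length p"
    using ex_has_greatest_nat[of ?path "[v]" length "Suc (card V)"] by (metis less_imp_le)
  obtain x p' where xp: "p = x # p'" using p by (cases p) auto
  have nbr: "y \<in> set p'" if "y \<in> V" "{x, y} \<in> snd G" for y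
  proof (rule ccontr)
    assume "y \<notin> set p'"
    moreover have "y \<noteq> x" using that(2) loopfree by auto
    moreover have "{(y # p) ! j, (y # p) ! Suc j} \<in> snd G" if "Suc j < length (y # p)" for j
      using that p \<open>{x, y} \<in> snd G\<close> xp by (cases j) (auto simp: insert_commute)
    ultimately have "?path (y # p)" using p that(1) xp by auto
    then show False using max by fastforce
  qed
  have "x \<in> V" using p xp by simp
  then obtain y z where yz: "y \<noteq> z" "y \<in> set p'" "z \<in> set p'" "{x, y} \<in> snd G" "{x, z} \<in> snd G"
    using deg nbr by meson
  \<comment> \<open>Of two distinct neighbours at most one has index 0 in \<open>p'\<close>, the
    place of the successor of \<open>x\<close>. The condition \<open>m > 0\<close> gives the cycle
    at least three vertices.\<close>
  obtain w m where w: "{x, w} \<in> snd G" "m < length p'" "p' ! m = w" "m > 0"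
    using yz by (metis gr0I in_set_conv_nth)
  \<comment> \<open>Since \<open>p' ! m\<close> is \<open>p ! Suc m\<close>, the prefix of length
    \<open>m + 2\<close> runs from \<open>x\<close> to \<open>w\<close>.\<close>
  define q where "q = take (m + 2) p"
  have len: "length q = m + 2" using w(2) xp by (simp add: q_def)
  have "{q ! j, q ! (Suc j mod length q)} \<in> snd G" if "j < length q" for j
  proof (cases "j = Suc m")
    case True
    then have "q ! j = w" "q ! (Suc j mod length q) = x" using w len by (auto simp: q_def xp)
    then show ?thesis using w(1) by (simp add: insert_commute)
  next
    case False
    then have "Suc j < length q" using that len by simp
    then show ?thesis using p by (auto simp: q_def)
  qed
  moreover have "set q \<subseteq> fst G" using p assms(3) set_take_subset[of "m + 2" p] unfolding q_def by blast
  moreover have "distinct q" using p by (simp add: q_def)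
  ultimately have "is_cycle G q" using len w(4) by (simp add: is_cycle_def)
  then show ?thesis by blast
qed

text \<open>Dropping members and applying an assignment to them both pass to a subgraph of the
  incidence graph.\<close>

lemma acyclic_family_mono:
  assumes "acyclic_family I F" "J \<subseteq> I" "\<And>i. i \<in> J \<Longrightarrow> cnf_vars (H i) \<subseteq> cnf_vars (F i)"
  shows "acyclic_family J H"
proof -
  have "fst (incidence_graph J H) \<subseteq> fst (incidence_graph I F)"
    "snd (incidence_graph J H) \<subseteq> snd (incidence_graph I F)"
    using assms(2,3) unfolding incidence_graph_def by fastforce+
  then have "is_cycle (incidence_graph I F) p" if "is_cycle (incidence_graph J H) p" for p
    using that unfolding is_cycle_def by blast
  then show ?thesis using assms(1) unfolding acyclic_family_def by blast
qed

text \<open>Otherwise every member has two variables in common with the rest, and each shared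
  variable lies in two members. The graph on all members and the shared variables then has minimum
  degree two.\<close>

lemma acyclic_family_leaf:
  assumes "finite I" "I \<noteq> {}" "acyclic_family I F" "\<And>i. i \<in> I \<Longrightarrow> finite (cnf_vars (F i))"
  obtains i v where "i \<in> I" "cnf_vars (F i) \<inter> (\<Union>j\<in>I - {i}. cnf_vars (F j)) \<subseteq> {v}"
proof (rule ccontr)
  assume "\<not> thesis"
  note no_thesis = this and leaf = that
  have noleaf: "\<not> cnf_vars (F i) \<inter> (\<Union>j\<in>I - {i}. cnf_vars (F j)) \<subseteq> {v}" if "i \<in> I" for i v
    using no_thesis leaf[OF that] by blast
  \<comment> \<open>Variables of a single member have degree one and are left out.\<close>
  define S where "S = {v. \<exists>i\<in>I. \<exists>j\<in>I. i \<noteq> j \<and> v \<in> cnf_vars (F i) \<and> v \<in> cnf_vars (F j)}"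
  let ?G = "incidence_graph I F"
  have edge: "{Inr i, Inl v} \<in> snd ?G" "{Inl v, Inr i} \<in> snd ?G" if "i \<in> I" "v \<in> cnf_vars (F i)" for i v
    using that by (auto simp: incidence_graph_def insert_commute)
  have "\<exists>p. is_cycle ?G p"
  proof (rule min_degree_2_imp_cycle)
    have "S \<subseteq> (\<Union>i\<in>I. cnf_vars (F i))" by (auto simp: S_def)
    then show "finite (Inl ` S \<union> Inr ` I)" "Inl ` S \<union> Inr ` I \<subseteq> fst ?G"
      using assms(1,4) finite_subset[of S] by (auto simp: incidence_graph_def)
    show "Inl ` S \<union> Inr ` I \<noteq> {}" using assms(2) by blast
    show "{x} \<notin> snd ?G" for x by (auto simp: incidence_graph_def)
    fix x assume "x \<in> Inl ` S \<union> Inr ` I"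
    then consider v where "x = Inl v" "v \<in> S" | i where "x = Inr i" "i \<in> I" by blast
    then show "\<exists>y\<in>Inl ` S \<union> Inr ` I. \<exists>z\<in>Inl ` S \<union> Inr ` I.
        y \<noteq> z \<and> {x, y} \<in> snd ?G \<and> {x, z} \<in> snd ?G"
    proof cases
      case 1
      then obtain i j where "i \<in> I" "j \<in> I" "i \<noteq> j" "v \<in> cnf_vars (F i)" "v \<in> cnf_vars (F j)"
        by (auto simp: S_def)
      then show ?thesis using edge 1(1)
        by (intro bexI[of _ "Inr i"] bexI[of _ "Inr j"]) auto
    next
      case 2
      obtain u where u: "u \<in> cnf_vars (F i)" "u \<in> (\<Union>j\<in>I - {i}. cnf_vars (F j))"
        using noleaf[OF 2(2)] by blast
      obtain w where w: "w \<in> cnf_vars (F i)" "w \<in> (\<Union>j\<in>I - {i}. cnf_vars (F j))" "w \<noteq> u"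
        using noleaf[OF 2(2), of u] by blast
      have "u \<in> S" "w \<in> S" using u w 2(2) by (auto simp: S_def)
      then show ?thesis using edge[OF 2(2)] u w 2(1)
        by (intro bexI[of _ "Inl u"] bexI[of _ "Inl w"]) auto
    qed
  qed
  then show False using assms(3) by (simp add: acyclic_family_def)
qed

section \<open>Gluing models\<close>

text \<open>Total models can be glued without regard to domains. Restricting one to the variables of
  \<open>F\<close> restores a finite domain.\<close>

lemma not_forced_iff_total_model:
  assumes "is_clause_set F"
  shows "\<not> forced F x \<longleftrightarrow>
    (\<exists>f. lit_val (Some \<circ> f) x = Some False \<and> (Some \<circ> f) \<star> F = {})"
proof
  assume "\<not> forced F x"
  then obtain \<phi> where \<phi>: "\<phi> \<star> lit_assign x False \<star> F = {}"
    unfolding forced_def satisfiable_def by blast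
  define \<theta> where "\<theta> = \<phi> ++ lit_assign x False"
  \<comment> \<open>Variables undefined under \<open>\<theta>\<close> get the value
    \<open>False\<close>; any other default would do.\<close>
  define f where "f v \<longleftrightarrow> \<theta> v = Some True" for v
  have f: "lit_val (Some \<circ> f) y = Some b" if "lit_val \<theta> y = Some b" for y b
    using that by (cases y) (auto simp: f_def)
  have "lit_val \<theta> x = Some False" unfolding \<theta>_def by (cases x) auto
  moreover have "\<theta> \<star> F = {}" using \<phi> by (simp add: \<theta>_def apply_apply)
  ultimately show "\<exists>f. lit_val (Some \<circ> f) x = Some False \<and> (Some \<circ> f) \<star> F = {}"
    unfolding apply_eq_empty_iff by (intro exI[of _ f] conjI) (simp add: f, meson f)
next
  assume "\<exists>f. lit_val (Some \<circ> f) x = Some False \<and> (Some \<circ> f) \<star> F = {}"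
  then obtain f where f: "lit_val (Some \<circ> f) x = Some False" "(Some \<circ> f) \<star> F = {}" by blast
  define \<phi> where "\<phi> = (Some \<circ> f) |` cnf_vars F"
  have "(Some \<circ> f) ++ lit_assign x False = Some \<circ> f"
    using f(1) by (cases x) (auto intro!: map_add_single_eq)
  then have "(Some \<circ> f) \<star> lit_assign x False \<star> F = {}" using f(2) by (simp add: apply_apply)
  moreover have "\<phi> v = (Some \<circ> f) v" if "v \<in> cnf_vars (lit_assign x False \<star> F)" for v
    using that cnf_vars_apply[of "lit_assign x False" F] by (auto simp: \<phi>_def)
  ultimately have "\<phi> \<star> lit_assign x False \<star> F = {}"
    using apply_eq_empty_cong[of "lit_assign x False \<star> F" \<phi> "Some \<circ> f"] by blast
  moreover have "finite (dom \<phi>)" using finite_cnf_vars[OF assms] by (simp add: \<phi>_def)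
  ultimately show "\<not> forced F x" unfolding forced_def satisfiable_def by blast
qed

lemma no_forced_iff:
  assumes "is_clause_set F"
  shows "(\<nexists>x. forced F x) \<longleftrightarrow> (\<forall>v b. \<exists>f. f v = b \<and> (Some \<circ> f) \<star> F = {})"
proof
  assume nf: "\<nexists>x. forced F x"
  show "\<forall>v b. \<exists>f. f v = b \<and> (Some \<circ> f) \<star> F = {}"
  proof (intro allI)
    fix v b
    show "\<exists>f. f v = b \<and> (Some \<circ> f) \<star> F = {}"
      \<comment> \<open>The literal chosen is the one that is false exactly when \<open>v\<close>
        has value \<open>b\<close>.\<close>
      using nf not_forced_iff_total_model[OF assms, of "if b then Neg v else Pos v"]
      by (cases b) auto
  qed
next
  assume m: "\<forall>v b. \<exists>f. f v = b \<and> (Some \<circ> f) \<star> F = {}"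
  show "\<nexists>x. forced F x"
  proof
    assume "\<exists>x. forced F x"
    then obtain x where x: "forced F x" by blast
    obtain f where "f (lit_var x) = (x = Neg (lit_var x))" "(Some \<circ> f) \<star> F = {}" using m by blast
    then show False using x not_forced_iff_total_model[OF assms, of x] by (cases x) auto
  qed
qed

text \<open>Induction removing a member that shares at most the variable \<open>u\<close> with the
  rest. The freely prescribed value carries the induction, as it makes the two partial solutions
  agree on \<open>u\<close>.\<close>

lemma glue_models:
  assumes "finite I" "acyclic_family I F" "\<And>i. i \<in> I \<Longrightarrow> is_clause_set (F i)"
    and "\<And>i v b. i \<in> I \<Longrightarrow> \<exists>f. f v = b \<and> (Some \<circ> f) \<star> F i = {}"
  shows "\<exists>f. f v = b \<and> (\<forall>i\<in>I. (Some \<circ> f) \<star> F i = {})"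
  using assms
proof (induction "card I" arbitrary: I v b rule: less_induct)
  case less
  show ?case
  proof (cases "I = {}")
    case True
    then show ?thesis by auto
  next
    case False
    obtain i u where i: "i \<in> I"
      and u: "cnf_vars (F i) \<inter> (\<Union>j\<in>I - {i}. cnf_vars (F j)) \<subseteq> {u}"
      using acyclic_family_leaf[OF less.prems(1) False less.prems(2)] finite_cnf_vars less.prems(3)
      by metis
    have rest: "\<exists>g. g w = c \<and> (\<forall>j\<in>I - {i}. (Some \<circ> g) \<star> F j = {})" for w c
    proof (rule less.hyps)
      show "card (I - {i}) < card I" using less.prems(1) i by (rule card_Diff1_less)
      show "acyclic_family (I - {i}) F" by (rule acyclic_family_mono[OF less.prems(2)]) auto
    qed (use less.prems in auto)
    \<comment> \<open>The side responsible for \<open>v\<close> is solved first with value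
      \<open>b\<close>; the other side is then solved with the value at \<open>u\<close> found
      there.\<close>
    have "\<exists>f g. f u = g u \<and> (Some \<circ> f) \<star> F i = {} \<and> (\<forall>j\<in>I - {i}. (Some \<circ> g) \<star> F j = {}) \<and>
        (if v \<in> cnf_vars (F i) then f v = b else g v = b)"
    proof (cases "v \<in> cnf_vars (F i)")
      case True
      obtain f where "f v = b" "(Some \<circ> f) \<star> F i = {}" using less.prems(4)[OF i] by blast
      moreover obtain g where "g u = f u" "\<forall>j\<in>I - {i}. (Some \<circ> g) \<star> F j = {}" using rest by blast
      ultimately show ?thesis using True by metis
    next
      case False
      obtain g where "g v = b" "\<forall>j\<in>I - {i}. (Some \<circ> g) \<star> F j = {}" using rest by blast
      moreover obtain f where "f u = g u" "(Some \<circ> f) \<star> F i = {}" using less.prems(4)[OF i] by blast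
      ultimately show ?thesis using False by metis
    qed
    then obtain f g where fg: "f u = g u" "(Some \<circ> f) \<star> F i = {}"
        "\<forall>j\<in>I - {i}. (Some \<circ> g) \<star> F j = {}"
        "if v \<in> cnf_vars (F i) then f v = b else g v = b" by (elim exE conjE) (rule that)
    define h where "h w = (if w \<in> cnf_vars (F i) then f w else g w)" for w
    have "(Some \<circ> h) \<star> F i = {}"
      using fg(2) apply_eq_empty_cong[of "F i" "Some \<circ> h" "Some \<circ> f"] by (simp add: h_def)
    moreover have "(Some \<circ> h) \<star> F j = {}" if "j \<in> I - {i}" for j
    proof -
      \<comment> \<open>A variable of \<open>F j\<close> where \<open>h\<close> follows
        \<open>f\<close> is shared with \<open>F i\<close>, so it is \<open>u\<close>, and there
        \<open>f\<close> and \<open>g\<close> agree.\<close>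
      have "h w = g w" if "w \<in> cnf_vars (F j)" for w
        using that \<open>j \<in> I - {i}\<close> u fg(1) by (auto simp: h_def)
      then show ?thesis
        using bspec[OF fg(3) that] apply_eq_empty_cong[of "F j" "Some \<circ> h" "Some \<circ> g"] by simp
    qed
    moreover have "h v = b" using fg(4) by (auto simp: h_def split: if_splits)
    ultimately show ?thesis by (metis DiffI singletonD)
  qed
qed

lemma no_forced_UN:
  assumes "finite I" "acyclic_family I F" "\<And>i. i \<in> I \<Longrightarrow> is_clause_set (F i)"
    and "\<And>i. i \<in> I \<Longrightarrow> \<nexists>x. forced (F i) x"
  shows "\<nexists>x. forced (\<Union>i\<in>I. F i) x"
proof -
  have "is_clause_set (\<Union>i\<in>I. F i)" using assms(1,3) by (auto simp: is_clause_set_def)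
  moreover have "\<exists>f. f v = b \<and> (Some \<circ> f) \<star> (\<Union>i\<in>I. F i) = {}" for v b
    using glue_models[OF assms(1-3), of v b] assms(4) no_forced_iff[OF assms(3)]
    by (simp add: apply_UN)
  ultimately show ?thesis using no_forced_iff by blast
qed

theorem theorem4p15:
  fixes k :: nat and I :: "'i set" and F :: "'i \<Rightarrow> 'v cnf"
  assumes "finite I"
    and "\<And>i. i \<in> I \<Longrightarrow> is_clause_set (F i)"
    and "acyclic_family I F"
    and "\<And>i. i \<in> I \<Longrightarrow> F i \<in> PC k"
  shows "(\<Union>i\<in>I. F i) \<in> PC k"
proof -
  let ?U = "\<Union>i\<in>I. F i"
  have U: "is_clause_set ?U" using assms(1,2) by (auto simp: is_clause_set_def)
  have "satisfiable (\<theta> \<star> ?U) \<and> (\<nexists>x. forced (\<theta> \<star> ?U) x)"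
    if \<theta>: "finite (dom \<theta>)" "red k (\<theta> \<star> ?U) = \<theta> \<star> ?U" "\<theta> \<star> ?U \<noteq> {{}}" for \<theta>
  proof -
    have cs: "is_clause_set (\<theta> \<star> F i)" if "i \<in> I" for i
      by (rule is_clause_set_apply[OF assms(2)[OF that]])
    have nf_i: "\<nexists>x. forced (\<theta> \<star> F i) x" if i: "i \<in> I" for i
    proof -
      have sub: "\<theta> \<star> F i \<subseteq> \<theta> \<star> ?U" using i by (intro apply_mono) blast
      have "red k (\<theta> \<star> F i) = \<theta> \<star> F i"
        using fixpoint_subset[OF cs[OF i] is_clause_set_apply[OF U] sub \<theta>(2,3)] .
      \<comment> \<open>If one member became \<open>{{}}\<close>, the reduced union would be a
        fixpoint containing the empty clause and hence \<open>{{}}\<close> itself.\<close>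
      moreover have "\<theta> \<star> F i \<noteq> {{}}"
        using sub fixpoint_empty_clause[OF is_clause_set_apply[OF U] \<theta>(2)] \<theta>(3) by auto
      ultimately show ?thesis
        using assms(4)[OF i] \<theta>(1)
        unfolding PC_iff_phd_bound phd_bound_iff_fixpoints[OF assms(2)[OF i]] by simp
    qed
    have "acyclic_family I (\<lambda>i. \<theta> \<star> F i)"
      by (rule acyclic_family_mono[OF assms(3)]) (auto intro: subsetD[OF cnf_vars_apply])
    then have nf: "\<nexists>x. forced (\<theta> \<star> ?U) x"
      unfolding apply_UN by (rule no_forced_UN[OF assms(1)]) (fact cs, fact nf_i)
    \<comment> \<open>Any literal serves: as it is not forced, setting it to 0 leaves a satisfiable
      instance.\<close>
    then have "satisfiable (\<theta> \<star> ?U)"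
      unfolding forced_def using satisfiable_apply finite_dom_lit_assign by blast
    with nf show ?thesis by blast
  qed
  then show ?thesis
    unfolding PC_iff_phd_bound phd_bound_iff_fixpoints[OF U] using U by simp
qed

end
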